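(* Let $n\geq 1$ be an integer, let $P(z)=z^{n}+a_{n-2}z^{n-2}+\cdots+a_0$ be a polynomial with constant complex coefficients (for $n=1$ this means $P(z)=z$), let $S(z)$ be a nonzero rational function, and put $h(z)=S(z)e^{P(z)}$. Let $\theta\in(0,\pi/(2n))$ be a constant and let $\varepsilon>0$ be a small constant. If $f(z)$ is a solution of the first order differential equation $$f'(z)=h(z)f(z)+1,$$ then there is a sequence $\{r_k\}_{k\ge 0}$ of real numbers $r_k>\dot r$ such that the set $E=\bigcup_{l=0}^{\infty}[r_{2l},r_{2l+1}]$ has infinite logarithmic measure and, for all $r\in E$, $$|f(re^{i\theta})|\geq (1-\varepsilon)\frac{\sqrt[n]{\sin n\theta}}{n}\,r\exp\left(e^{(1-\varepsilon)r^n\cos n\theta}\sin\varepsilon\right).$$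
   Context: $\dot r>0$ is a number such that all poles of $S(z)$ lie in the open disk $D(0,\dot r)=\{z:|z|<\dot r\}$; a solution $f$ is regarded as an analytic function outside $D(0,\dot r)$. A set $E\subset(0,\infty)$ has infinite logarithmic measure if $\int_E dr/r=\infty$. "Small constant $\varepsilon>0$" means that the assertion holds for every sufficiently small $\varepsilon>0$; the sequence $\{r_k\}$ may depend on $\varepsilon$, $\theta$ and $f$. *)

theory Defs
  imports "HOL-Complex_Analysis.Complex_Analysis"
begin

text \<open>Rational functions are complex functions given by a fraction in lowest terms. Coprimality
  ensures that the zeros of the denominator, where division by zero assigns the junk value 0,
  are exactly the poles, so that there are no removable singularities with a wrong value.\<close>

definition rational_function :: "(complex \<Rightarrow> complex) \<Rightarrow> bool" where
  "rational_function S \<longleftrightarrow>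
     (\<exists>p q :: complex poly. q \<noteq> 0 \<and> coprime p q \<and> S = (\<lambda>z. poly p z / poly q z))"

text \<open>The first order linear equation \<open>f' = h f + 1\<close>. The disk \<open>D(0, R)\<close> is open, so the set
  outside it includes the circle \<open>|z| = R\<close>; \<open>analytic_on\<close> means analytic in a
  neighbourhood of each of its points.\<close>

definition solution_outside :: "real \<Rightarrow> (complex \<Rightarrow> complex) \<Rightarrow> (complex \<Rightarrow> complex) \<Rightarrow> bool" where
  "solution_outside R h f \<longleftrightarrow>
     f analytic_on (- ball 0 R) \<and> (\<forall>z \<in> - ball 0 R. deriv f z = h z * f z + 1)"

text \<open>Intended for Borel sets of positive reals.\<close>

definition log_measure :: "real set \<Rightarrow> ennreal" where
  "log_measure E = (\<integral>\<^sup>+ r \<in> E. ennreal (1 / r) \<partial>lborel)"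

end

theory Submission imports Defs "HOL-Real_Asymp.Real_Asymp" begin

text \<open>If \<open>H\<close> is a primitive of \<open>h\<close>, every solution is \<open>f = F e\<^sup>H\<close> with \<open>F' = e\<^bsup>-H\<^esup>\<close>. Near the
ray \<open>arg z = \<theta>\<close> the function \<open>H\<close> is close to \<open>S e\<^sup>P / P'\<close>, which rotates as \<open>z\<close> moves along
the ray; where its argument is within \<open>\<pi>/3\<close> of \<open>0\<close> modulo \<open>2\<pi>\<close>, the factor \<open>e\<^sup>H\<close> is doubly exponentially large. What
has to be excluded is that \<open>F\<close> is tiny there.

To see that it is not, a new coordinate \<open>u\<close> is used in which \<open>h dz = e\<^sup>u (1 + small) du\<close>. It is built
in two steps: \<open>w = z\<^sup>n\<close>, and then \<open>u = w + g w\<close>, where \<open>g\<close> collects the lower terms of \<open>P\<close>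
and the logarithm of the leading behaviour of \<open>S / (n z\<^bsup>n-1\<^esup>)\<close>. As \<open>g'\<close> tends to \<open>0\<close>, the second map is
invertible by the contraction principle (\<open>near_identity_inverse\<close>), and its inverse is
defined on a region \<open>Im u > B + k \<bar>u\<bar>\<close> (\<open>straightening\<close>). A function whose derivative is
\<open>O(e\<^bsup>Re u\<^esup>)\<close> on such a region differs from a constant by \<open>O(e\<^bsup>Re u\<^esup>)\<close> (\<open>exp_decay_limit\<close>). Applied to
\<open>H - e\<^sup>u\<close> this gives \<open>H = e\<^sup>u (1 + small)\<close> after normalising \<open>H\<close>, and applied to \<open>F - z(u)\<close> on
\<open>Re u \<le> 0\<close>, where \<open>e\<^bsup>-H\<^esup> = 1 + O(e\<^bsup>Re u\<^esup>)\<close>, it gives \<open>F = z(u) + O(1)\<close>. Going from \<open>i y\<close> to \<open>x + i y\<close>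
with \<open>cos y \<ge> 1/2\<close>, \<open>F\<close> changes only by \<open>O(1)\<close>, because \<open>e\<^bsup>-H\<^esup>\<close> decays there. Since \<open>z(i y)\<close> tends to
infinity with \<open>y\<close>, \<open>\<bar>F\<bar> \<ge> 1\<close> for large \<open>y\<close>, whence \<open>\<bar>f\<bar> \<ge> exp (3/8 e\<^bsup>Re u\<^esup>)\<close>
(\<open>growth_in_tracts\<close>).

On the ray, \<open>Re u \<ge> (1 - \<epsilon>/4) r\<^sup>n cos n\<theta> - O(1)\<close>, so this beats the required bound. As a function of
\<open>t = r\<^sup>n\<close>, \<open>Im u\<close> increases at a rate between two positive constants. Hence the \<open>l\<close>-th interval where it
is within \<open>\<pi>/3\<close> of a multiple of \<open>2\<pi>\<close> has logarithmic length at least a constant times \<open>1/(l + 1)\<close>, and these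
lengths have infinite sum (\<open>intervals_of_large_cosine\<close>).\<close>

section \<open>Functions with exponentially decaying derivative\<close>

lemma bound_along_path:
  fixes f f' :: "complex \<Rightarrow> complex" and g :: "real \<Rightarrow> complex"
  assumes "a \<le> b"
    and f: "\<And>t. a \<le> t \<Longrightarrow> t \<le> b \<Longrightarrow> (f has_field_derivative f' (g t)) (at (g t))"
    and g: "\<And>t. (g has_vector_derivative d) (at t)"
    and phi: "\<And>t. (\<phi> has_real_derivative \<phi>' t) (at t)"
    and bnd: "\<And>t. a \<le> t \<Longrightarrow> t \<le> b \<Longrightarrow> norm (d * f' (g t)) \<le> \<phi>' t"
  shows "norm (f (g b) - f (g a)) \<le> \<phi> b - \<phi> a"
proof (cases "a = b")
  case False
  have fg: "((\<lambda>t. f (g t)) has_vector_derivative d * f' (g t)) (at t)" if "a \<le> t" "t \<le> b" for t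
    using field_vector_diff_chain_at[OF g f[OF that]] by (simp add: o_def)
  show ?thesis
  proof (rule differentiable_bound_general[where f' = "\<lambda>t. d * f' (g t)" and \<phi>' = \<phi>'])
    show "a < b" using False assms(1) by simp
    show "continuous_on {a..b} (\<lambda>t. f (g t))"
      by (rule continuous_at_imp_continuous_on) (use fg has_vector_derivative_continuous in fastforce)
    show "continuous_on {a..b} \<phi>"
      by (rule continuous_at_imp_continuous_on) (use phi DERIV_isCont in blast)
  qed (use fg phi bnd in \<open>auto simp: has_real_derivative_iff_has_vector_derivative\<close>)
qed simp

text \<open>The direction \<open>\<i> - 1\<close> leads to \<open>Re u \<rightarrow> -\<infinity>\<close> and climbs at the same time, so that it stays inside the regions
\<open>Im u > B + k \<bar>u\<bar>\<close> for small \<open>k\<close>; a horizontal line would leave them. The constant \<open>2\<close> bounds the speed \<open>\<bar>\<i> - 1\<bar>\<close> of the path.\<close>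

lemma exp_decay_limit:
  fixes G G' :: "complex \<Rightarrow> complex"
  assumes "convex V"
    and shift: "\<And>u t. u \<in> V \<Longrightarrow> t \<ge> 0 \<Longrightarrow> u + of_real t * (\<i> - 1) \<in> V"
    and deriv: "\<And>u. u \<in> V \<Longrightarrow> (G has_field_derivative G' u) (at u)"
    and bnd: "\<And>u. u \<in> V \<Longrightarrow> norm (G' u) \<le> C * exp (Re u)"
  shows "\<exists>L. \<forall>u\<in>V. norm (G u - L) \<le> 2 * C * exp (Re u)"
proof (cases "V = {}")
  case False
  then obtain u0 where u0: "u0 \<in> V" by blast
  have "0 \<le> C * exp (Re u0)" using bnd[OF u0] norm_ge_zero order_trans by blast
  then have C: "C \<ge> 0" by (simp add: zero_le_mult_iff)
  have sqrt2: "norm (\<i> - 1) \<le> 2"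
    using norm_triangle_ineq4[of \<i> 1] by simp
  define \<gamma> where "\<gamma> u t = u + of_real t * (\<i> - 1)" for u and t :: real
  have Re\<gamma>: "Re (\<gamma> u t) = Re u - t" for u t by (simp add: \<gamma>_def)
  have along: "norm (G (\<gamma> u b) - G (\<gamma> u a)) \<le> 2 * C * exp (Re u - a)"
    if u: "u \<in> V" and ab: "0 \<le> a" "a \<le> b" for u a b
  proof -
    have "norm (G (\<gamma> u b) - G (\<gamma> u a)) \<le> - (2 * C * exp (Re u - b)) - (- (2 * C * exp (Re u - a)))"
    proof (rule bound_along_path[OF \<open>a \<le> b\<close>, where f = G and f' = G' and g = "\<gamma> u" and d = "\<i> - 1"])
      show "(G has_field_derivative G' (\<gamma> u t)) (at (\<gamma> u t))" if "a \<le> t" for t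
        using that ab by (intro deriv) (auto simp: \<gamma>_def intro!: shift u)
      show "(\<gamma> u has_vector_derivative \<i> - 1) (at t)" for t
        unfolding \<gamma>_def by (auto intro!: derivative_eq_intros)
      show "((\<lambda>t. - (2 * C * exp (Re u - t))) has_real_derivative 2 * C * exp (Re u - t)) (at t)" for t
        by (auto intro!: derivative_eq_intros)
      show "norm ((\<i> - 1) * G' (\<gamma> u t)) \<le> 2 * C * exp (Re u - t)" if "a \<le> t" for t
      proof -
        have "norm (G' (\<gamma> u t)) \<le> C * exp (Re u - t)"
          using bnd[of "\<gamma> u t"] that ab shift[OF u] by (simp add: Re\<gamma>) (simp add: \<gamma>_def)
        then show ?thesis using sqrt2 C
          unfolding norm_mult by (metis mult.assoc mult_mono norm_ge_zero zero_le_numeral)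
      qed
    qed
    moreover have "0 \<le> 2 * C * exp (Re u - b)" using C by simp
    ultimately show ?thesis by linarith
  qed
  define X where "X u k = G (\<gamma> u (real k))" for u and k :: nat
  have conv: "convergent (X u)" if u: "u \<in> V" for u
  proof -
    have "Cauchy (X u)"
    proof (rule CauchyI)
      fix e :: real assume "0 < e"
      have "(\<lambda>k::nat. exp (Re u - real k)) \<longlonglongrightarrow> 0"
        by real_asymp
      then have "(\<lambda>k::nat. 2 * C * exp (Re u - real k)) \<longlonglongrightarrow> 0"
        by (rule tendsto_mult_right_zero)
      then have "\<forall>\<^sub>F k in sequentially. 2 * C * exp (Re u - real k) < e / 2"
        using \<open>0 < e\<close> by (intro order_tendstoD) auto
      then obtain N where N: "2 * C * exp (Re u - real N) < e / 2"
        by (auto simp: eventually_sequentially)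
      have half: "norm (X u m - X u N) < e / 2" if "m \<ge> N" for m
        using along[OF u, of "real N" "real m"] that N by (simp add: X_def)
      show "\<exists>M. \<forall>m\<ge>M. \<forall>n\<ge>M. norm (X u m - X u n) < e"
      proof (intro exI allI impI)
        fix m n assume "m \<ge> N" "n \<ge> N"
        then show "norm (X u m - X u n) < e"
          using half[of m] half[of n] by (metis norm_diff_triangle_less field_sum_of_halves norm_minus_commute)
      qed
    qed
    then show ?thesis by (simp add: Cauchy_convergent_iff)
  qed
  define L where "L u = lim (X u)" for u
  have XL: "X u \<longlonglongrightarrow> L u" if "u \<in> V" for u
    using conv[OF that] by (simp add: convergent_LIMSEQ_iff L_def)
  have L1: "norm (G u - L u) \<le> 2 * C * exp (Re u)" if u: "u \<in> V" for u
  proof (rule tendsto_upperbound[OF _ always_eventually])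
    show "(\<lambda>k. norm (G u - X u k)) \<longlonglongrightarrow> norm (G u - L u)"
      by (intro tendsto_intros XL u)
    show "\<forall>k. norm (G u - X u k) \<le> 2 * C * exp (Re u)"
      using along[OF u, of 0 "real k" for k] by (auto simp: X_def \<gamma>_def norm_minus_commute)
  qed simp
  \<comment> \<open>The limits along two parallel rays agree, because the rays stay at bounded distance.\<close>
  have L2: "L u = L v" if u: "u \<in> V" and v: "v \<in> V" for u v
  proof -
    define m where "m = max (Re u) (Re v)"
    have le: "norm (X u k - X v k) \<le> C * exp (m - real k) * norm (u - v)" for k
    proof -
      have conv: "convex (V \<inter> {z. Re z \<le> m - real k})"
        by (intro convex_Int assms(1) convex_halfspace_Re_le)
      have "norm (X u k - X v k) \<le> C * exp (m - real k) * norm (\<gamma> u (real k) - \<gamma> v (real k))"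
        unfolding X_def
      proof (rule field_differentiable_bound[OF conv, of G G'])
        show "norm (G' z) \<le> C * exp (m - real k)" if "z \<in> V \<inter> {z. Re z \<le> m - real k}" for z
          using order_trans[OF bnd[of z] mult_left_mono[of "exp (Re z)" "exp (m - real k)" C]] that C
          by auto
      qed (use u v shift[of u "real k"] shift[of v "real k"] deriv in \<open>auto simp: m_def Re\<gamma> \<gamma>_def intro: has_field_derivative_at_within\<close>)
      then show ?thesis by (simp add: \<gamma>_def)
    qed
    have "(\<lambda>k::nat. exp (m - real k)) \<longlonglongrightarrow> 0"
      by real_asymp
    then have "(\<lambda>k::nat. C * exp (m - real k) * norm (u - v)) \<longlonglongrightarrow> 0"
      by (intro tendsto_mult_left_zero tendsto_mult_right_zero)
    then have "(\<lambda>k. X u k - X v k) \<longlonglongrightarrow> 0"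
      by (rule Lim_null_comparison[rotated]) (intro always_eventually allI le)
    moreover have "(\<lambda>k. X u k - X v k) \<longlonglongrightarrow> L u - L v"
      by (intro tendsto_intros XL u v)
    ultimately show ?thesis using LIMSEQ_unique by fastforce
  qed
  show ?thesis
    using L1 L2[OF _ u0] by (intro exI[of _ "L u0"]) auto
qed simp

section \<open>Inverting a perturbation of the identity\<close>

text \<open>A function with derivative at most \<open>\<eta>\<close> on a half-plane may still be as large as \<open>\<eta> \<bar>w\<bar>\<close>, so the image of
the half-plane under \<open>w + g w\<close> need not contain a half-plane; it contains the points with
\<open>Im u\<close> larger than a constant plus \<open>2 \<eta> \<bar>u\<bar>\<close>.\<close>

lemma near_identity_inverse:
  fixes g g' :: "complex \<Rightarrow> complex"
  assumes g: "\<And>w :: complex. Im w > K \<Longrightarrow> (g has_field_derivative g' w) (at w)"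
    and bnd: "\<And>w :: complex. Im w > K \<Longrightarrow> norm (g' w) \<le> \<eta>"
    and \<eta>: "0 < \<eta>" "\<eta> < 1/2"
  obtains A \<kappa> where "A \<ge> 0"
    and "\<And>w v :: complex. Im w > K \<Longrightarrow> Im v > K \<Longrightarrow> norm (g w - g v) \<le> \<eta> * norm (w - v)"
    and "\<And>w :: complex. Im w > K \<Longrightarrow> norm (g w) \<le> A + \<eta> * norm w"
    and "\<And>u. Im u > K + 2 * A + 2 * \<eta> * norm u \<Longrightarrow> Im (\<kappa> u) > K"
    and "\<And>u. Im u > K + 2 * A + 2 * \<eta> * norm u \<Longrightarrow> \<kappa> u + g (\<kappa> u) = u"
    and "\<And>u. Im u > K + 2 * A + 2 * \<eta> * norm u \<Longrightarrow>
           (\<kappa> has_field_derivative 1 / (1 + g' (\<kappa> u))) (at u)"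
    and "\<And>w :: complex. Im w > K \<Longrightarrow> \<kappa> (w + g w) = w"
proof -
  let ?U = "{w. Im w > K}"
  have oU: "open ?U" by (rule open_halfspace_Im_gt)
  have cU: "convex ?U" by (rule convex_halfspace_Im_gt)
  have lip: "norm (g w - g v) \<le> \<eta> * norm (w - v)" if "Im w > K" "Im v > K" for w v
    by (rule field_differentiable_bound[OF cU, of g g'])
       (use that g bnd in \<open>auto intro: has_field_derivative_at_within\<close>)
  define w0 where "w0 = \<i> * of_real (K + 1)"
  define A where "A = norm (g w0) + \<eta> * norm w0"
  have A: "A \<ge> 0" using \<eta> by (simp add: A_def)
  have gA: "norm (g w) \<le> A + \<eta> * norm w" if "Im w > K" for w :: complex
  proof -
    have "norm (g w) \<le> norm (g w0) + norm (g w - g w0)" by (rule norm_triangle_sub)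
    also have "norm (g w - g w0) \<le> \<eta> * norm (w - w0)"
      using that by (intro lip) (auto simp: w0_def)
    also have "\<dots> \<le> \<eta> * (norm w + norm w0)"
      using \<eta> by (intro mult_left_mono norm_triangle_ineq4) auto
    finally show ?thesis by (simp add: A_def algebra_simps)
  qed
  define \<Phi> where "\<Phi> w = w + g w" for w
  have d\<Phi>: "(\<Phi> has_field_derivative 1 + g' w) (at w)" if "Im w > K" for w
    unfolding \<Phi>_def using g[OF that] by (auto intro!: derivative_eq_intros)
  have inj: "inj_on \<Phi> ?U"
  proof (rule inj_onI)
    fix w v assume wv: "w \<in> ?U" "v \<in> ?U" "\<Phi> w = \<Phi> v"
    have "w - v = g v - g w" using wv(3) by (simp add: \<Phi>_def algebra_simps)
    then have "norm (w - v) \<le> \<eta> * norm (w - v)"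
      using lip[of v w] wv by (metis mem_Collect_eq norm_minus_commute)
    then have "(1 - \<eta>) * norm (w - v) \<le> 0" by (simp add: algebra_simps)
    then show "w = v" using \<eta> by (simp add: mult_le_0_iff)
  qed
  have hol: "\<Phi> holomorphic_on ?U"
    using d\<Phi> by (intro holomorphic_onI) (auto intro: has_field_derivative_at_within simp: field_differentiable_def)
  obtain \<kappa> where \<kappa>hol: "\<kappa> holomorphic_on (\<Phi> ` ?U)"
    and \<kappa>d: "\<And>w. w \<in> ?U \<Longrightarrow> deriv \<Phi> w * deriv \<kappa> (\<Phi> w) = 1"
    and \<kappa>: "\<And>w. w \<in> ?U \<Longrightarrow> \<kappa> (\<Phi> w) = w"
    using holomorphic_has_inverse[OF hol oU inj] by metis
  \<comment> \<open>The equation \<open>w + g w = u\<close> is solved as the fixed point of the contraction \<open>u - g w\<close>.\<close>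
  have surj: "\<exists>w\<in>?U. \<Phi> w = u" if u: "Im u > K + 2 * A + 2 * \<eta> * norm u" for u
  proof -
    define \<rho> where "\<rho> = 2 * (A + \<eta> * norm u)"
    have \<rho>: "\<rho> \<ge> 0" using A \<eta> by (simp add: \<rho>_def)
    have sub: "Im w > K" if "w \<in> cball u \<rho>" for w
    proof -
      have "\<bar>Im (u - w)\<bar> \<le> norm (u - w)" by (rule abs_Im_le_cmod)
      then show ?thesis using that u by (simp add: dist_norm \<rho>_def algebra_simps)
    qed
    have "\<exists>!w\<in>cball u \<rho>. u - g w = w"
    proof (rule Banach_fix[where c = \<eta>])
      show "complete (cball u \<rho>)" by (simp add: compact_imp_complete)
      show "(\<lambda>w. u - g w) ` cball u \<rho> \<subseteq> cball u \<rho>"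
      proof safe
        fix w assume w: "w \<in> cball u \<rho>"
        have uK: "Im u > K" using sub[of u] \<rho> by simp
        have "norm (g w) \<le> norm (g u) + norm (g w - g u)" by (rule norm_triangle_sub)
        also have "\<dots> \<le> (A + \<eta> * norm u) + \<eta> * norm (w - u)"
          by (intro add_mono gA lip sub w uK)
        also have "\<dots> \<le> (A + \<eta> * norm u) + 1/2 * \<rho>"
          using w \<eta> by (intro add_mono mult_mono order_refl) (auto simp: dist_norm norm_minus_commute)
        finally show "u - g w \<in> cball u \<rho>" by (simp add: \<rho>_def dist_norm field_simps)
      qed
      show "dist (u - g w) (u - g v) \<le> \<eta> * dist w v" if "w \<in> cball u \<rho>" "v \<in> cball u \<rho>" for w v
        using lip[of v w] sub that by (simp add: dist_norm norm_minus_commute)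
    qed (use \<eta> \<rho> in auto)
    then obtain w where "w \<in> cball u \<rho>" "u - g w = w" by blast
    then show ?thesis using sub by (intro bexI[of _ w]) (auto simp: \<Phi>_def algebra_simps)
  qed
  have main: "Im (\<kappa> u) > K \<and> \<kappa> u + g (\<kappa> u) = u \<and>
      (\<kappa> has_field_derivative 1 / (1 + g' (\<kappa> u))) (at u)"
    if u: "Im u > K + 2 * A + 2 * \<eta> * norm u" for u
  proof -
    obtain w where w: "Im w > K" "\<Phi> w = u" using surj[OF u] by auto
    have \<kappa>u: "\<kappa> u = w" using w \<kappa> by auto
    have "open (\<Phi> ` ?U)" by (rule open_mapping_thm3[OF hol oU inj])
    then have "\<kappa> field_differentiable at u"
      using \<kappa>hol w holomorphic_on_imp_differentiable_at by blast
    moreover have "(1 + g' w) * deriv \<kappa> u = 1"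
      using \<kappa>d[of w] w DERIV_imp_deriv[OF d\<Phi>[OF w(1)]] by simp
    then have "deriv \<kappa> u = 1 / (1 + g' w)" by (metis mult_zero_left nonzero_eq_divide_eq mult.commute zero_neq_one)
    ultimately have "(\<kappa> has_field_derivative 1 / (1 + g' w)) (at u)"
      by (metis DERIV_deriv_iff_field_differentiable)
    then show ?thesis using w \<kappa>u by (simp add: \<Phi>_def)
  qed
  show ?thesis
    by (rule that[OF A lip gA]) (use main \<kappa> in \<open>auto simp: \<Phi>_def\<close>)
qed

text \<open>The region above a branch of a hyperbola (for \<open>0 < k < 1\<close> and \<open>B > 0\<close>), asymptotic to a sector
symmetric about the upper imaginary axis. It replaces an upper half-plane; \<open>k\<close> measures how far the sector is from being one.\<close>

definition tilted_half_plane :: "real \<Rightarrow> real \<Rightarrow> complex set" where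
  "tilted_half_plane B k = {u. Im u > B + k * norm u}"

lemma open_tilted_half_plane: "open (tilted_half_plane B k)"
  unfolding tilted_half_plane_def by (intro open_Collect_less continuous_intros)

lemma convex_tilted_half_plane:
  assumes "k \<ge> 0"
  shows "convex (tilted_half_plane B k)"
proof (rule convexI)
  fix u v :: complex and s t :: real
  assume uv: "u \<in> tilted_half_plane B k" "v \<in> tilted_half_plane B k"
    and st: "0 \<le> s" "0 \<le> t" "s + t = 1"
  have "B + k * norm (s *\<^sub>R u + t *\<^sub>R v) \<le> (s + t) * B + k * (s * norm u + t * norm v)"
    using assms st norm_triangle_ineq[of "s *\<^sub>R u" "t *\<^sub>R v"] by (simp add: mult_left_mono)
  also have "\<dots> = s * (B + k * norm u) + t * (B + k * norm v)" by (simp add: algebra_simps)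
  also have "\<dots> < s * Im u + t * Im v"
  proof (cases "s = 0")
    case True
    then show ?thesis using uv st by (simp add: tilted_half_plane_def)
  next
    case False
    then have "s * (B + k * norm u) < s * Im u" "t * (B + k * norm v) \<le> t * Im v"
      using uv st by (auto simp: tilted_half_plane_def intro!: mult_left_mono)
    then show ?thesis by linarith
  qed
  finally show "s *\<^sub>R u + t *\<^sub>R v \<in> tilted_half_plane B k" by (simp add: tilted_half_plane_def)
qed

lemma tilted_half_plane_shift:
  assumes u: "u \<in> tilted_half_plane B k" and "t \<ge> 0" "0 \<le> k" "k \<le> 1/2"
  shows "u + of_real t * (\<i> - 1) \<in> tilted_half_plane B k"
proof -
  have "norm (u + of_real t * (\<i> - 1)) \<le> norm u + t * norm (\<i> - 1)"
    using norm_triangle_ineq[of u "of_real t * (\<i> - 1)"] \<open>t \<ge> 0\<close> by (simp add: norm_mult)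
  also have "\<dots> \<le> norm u + t * 2"
    using norm_triangle_ineq4[of \<i> 1] \<open>t \<ge> 0\<close> by (intro add_mono mult_left_mono) auto
  finally have "k * norm (u + of_real t * (\<i> - 1)) \<le> k * (norm u + t * 2)"
    using assms by (intro mult_left_mono) auto
  also have "\<dots> = k * norm u + (k * 2) * t" by (simp add: algebra_simps)
  also have "\<dots> \<le> k * norm u + 1 * t" using assms by (intro add_mono mult_right_mono) auto
  finally show ?thesis using u by (simp add: tilted_half_plane_def)
qed

lemma tilted_half_plane_toward_axis:
  assumes u: "u \<in> tilted_half_plane B k" and "0 \<le> t" "t \<le> Re u" "0 \<le> k"
  shows "of_real t + \<i> * of_real (Im u) \<in> tilted_half_plane B k"
proof -
  have "norm (of_real t + \<i> * of_real (Im u)) \<le> norm u"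
    using assms by (simp add: cmod_def power_mono)
  then have "k * norm (of_real t + \<i> * of_real (Im u)) \<le> k * norm u"
    using assms by (intro mult_left_mono) auto
  then show ?thesis using u by (simp add: tilted_half_plane_def)
qed

section \<open>Growth of solutions in the straightened coordinate\<close>

lemma norm_exp_minus_one_le:
  fixes z :: complex
  shows "norm (exp z - 1) \<le> exp (norm z) * norm z"
proof -
  have "norm (exp z - exp 0) \<le> exp (norm z) * norm (z - 0)"
  proof (rule field_differentiable_bound[of "cball 0 (norm z)" exp exp])
    show "norm (exp w) \<le> exp (norm z)" if "w \<in> cball 0 (norm z)" for w :: complex
      using that complex_Re_le_cmod[of w] by (simp add: norm_exp_eq_Re)
  qed (auto intro: DERIV_exp has_field_derivative_at_within)
  then show ?thesis by simp
qed

text \<open>Here \<open>\<zeta>\<close> plays the role of \<open>z\<close> as a function of \<open>u\<close>, \<open>\<psi> = h(\<zeta>) \<zeta>'\<close>, and \<open>\<phi> = f(\<zeta>)\<close>, so that the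
equation \<open>f' = h f + 1\<close> becomes \<open>\<phi>' = \<psi> \<phi> + \<zeta>'\<close>.\<close>

lemma growth_in_tracts:
  fixes \<phi> \<psi> \<zeta> \<zeta>' :: "complex \<Rightarrow> complex"
  assumes V: "convex V" "open V"
    and shift: "\<And>u t. u \<in> V \<Longrightarrow> t \<ge> 0 \<Longrightarrow> u + of_real t * (\<i> - 1) \<in> V"
    and axis: "\<And>u t. u \<in> V \<Longrightarrow> 0 \<le> t \<Longrightarrow> t \<le> Re u \<Longrightarrow> of_real t + \<i> * of_real (Im u) \<in> V"
    and \<zeta>: "\<And>u. u \<in> V \<Longrightarrow> (\<zeta> has_field_derivative \<zeta>' u) (at u)"
    and \<zeta>_bnd: "\<And>u. u \<in> V \<Longrightarrow> norm (\<zeta>' u) \<le> M"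
    and \<psi>: "\<psi> holomorphic_on V"
    and \<psi>_bnd: "\<And>u. u \<in> V \<Longrightarrow> norm (\<psi> u - exp u) \<le> exp (Re u) / 16"
    and \<phi>: "\<And>u. u \<in> V \<Longrightarrow> (\<phi> has_field_derivative \<psi> u * \<phi> u + \<zeta>' u) (at u)"
  shows "\<exists>C. \<forall>u\<in>V. Re u \<ge> 0 \<longrightarrow> cos (Im u) \<ge> 1/2 \<longrightarrow> norm (\<zeta> (\<i> * of_real (Im u))) \<ge> C
           \<longrightarrow> norm (\<phi> u) \<ge> exp (3/8 * exp (Re u))"
proof (cases "V = {}")
  case False
  then have M: "M \<ge> 0" using \<zeta>_bnd norm_ge_zero order_trans by (metis all_not_in_conv)
  obtain H0 where H0: "\<And>u. u \<in> V \<Longrightarrow> (H0 has_field_derivative \<psi> u) (at u)"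
    using holomorphic_convex_primitive'[OF V \<psi>] V at_within_open by metis
  obtain L where L: "\<And>u. u \<in> V \<Longrightarrow> norm (H0 u - exp u - L) \<le> 2 * (1/16) * exp (Re u)"
    using exp_decay_limit[OF V(1) shift, of "\<lambda>u. H0 u - exp u" "\<lambda>u. \<psi> u - exp u" "1/16"] \<psi>_bnd
    by (force intro!: derivative_eq_intros H0)
  define H where "H u = H0 u - L" for u
  have H: "(H has_field_derivative \<psi> u) (at u)" if "u \<in> V" for u
    unfolding H_def using H0[OF that] by (auto intro!: derivative_eq_intros)
  have Hexp: "norm (H u - exp u) \<le> exp (Re u) / 8" if "u \<in> V" for u
    using L[OF that] by (simp add: H_def algebra_simps)
  \<comment> \<open>The factor of \<open>\<phi>\<close> obtained by variation of constants; it is close to \<open>\<zeta>\<close> where \<open>H\<close> is small.\<close>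
  define F where "F u = \<phi> u * exp (- H u)" for u
  have F: "(F has_field_derivative \<zeta>' u * exp (- H u)) (at u)" if "u \<in> V" for u
    unfolding F_def using \<phi>[OF that] H[OF that]
    by (auto intro!: derivative_eq_intros simp: algebra_simps)
  let ?V0 = "V \<inter> {u. Re u \<le> 0}"
  have "\<exists>L. \<forall>u\<in>?V0. norm (F u - \<zeta> u - L) \<le> 2 * (M * (exp 2 * 2)) * exp (Re u)"
  proof (rule exp_decay_limit)
    show "convex ?V0" by (intro convex_Int V convex_halfspace_Re_le)
    show "u + of_real t * (\<i> - 1) \<in> ?V0" if "u \<in> ?V0" "t \<ge> 0" for u t
      using that shift by auto
    show "((\<lambda>u. F u - \<zeta> u) has_field_derivative \<zeta>' u * (exp (- H u) - 1)) (at u)" if "u \<in> ?V0" for u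
      using F[of u] \<zeta>[of u] that by (auto intro!: derivative_eq_intros simp: algebra_simps)
    show "norm (\<zeta>' u * (exp (- H u) - 1)) \<le> M * (exp 2 * 2) * exp (Re u)" if u: "u \<in> ?V0" for u
    proof -
      have "norm (H u) \<le> norm (exp u) + norm (H u - exp u)" by (rule norm_triangle_sub)
      also have "\<dots> \<le> 2 * exp (Re u)" using Hexp[of u] u exp_ge_zero[of "Re u"] by (simp del: exp_ge_zero)
      finally have 1: "norm (H u) \<le> 2 * exp (Re u)" .
      moreover have "exp (Re u) \<le> 1" using u by simp
      ultimately have 2: "norm (H u) \<le> 2" by linarith
      have "norm (exp (- H u) - 1) \<le> exp (norm (H u)) * norm (H u)"
        using norm_exp_minus_one_le[of "- H u"] by simp
      also have "\<dots> \<le> exp 2 * (2 * exp (Re u))"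
        using 1 2 by (intro mult_mono) auto
      finally have "norm (\<zeta>' u) * norm (exp (- H u) - 1) \<le> M * (exp 2 * (2 * exp (Re u)))"
        using \<zeta>_bnd[of u] u M by (intro mult_mono) auto
      then show ?thesis by (simp add: norm_mult mult_ac)
    qed
  qed
  then obtain L' where L': "\<And>u. u \<in> ?V0 \<Longrightarrow> norm (F u - \<zeta> u - L') \<le> 2 * (M * (exp 2 * 2)) * exp (Re u)"
    by blast
  \<comment> \<open>The three last terms are the limit of \<open>F - \<zeta>\<close> at the left end, the error at \<open>Re u = 0\<close> and the horizontal leg.\<close>
  define C where "C = 1 + norm L' + 4 * M * exp 2 + 8/3 * M"
  show ?thesis
  proof (intro exI[of _ C] ballI impI)
    fix u assume u: "u \<in> V" and x: "Re u \<ge> 0" and cos: "cos (Im u) \<ge> 1/2"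
      and big: "norm (\<zeta> (\<i> * of_real (Im u))) \<ge> C"
    define p where "p t = of_real t + \<i> * of_real (Im u)" for t
    have pu: "p (Re u) = u" by (simp add: p_def complex_eq_iff)
    have pV: "p t \<in> V" if "0 \<le> t" "t \<le> Re u" for t
      using axis[OF u that] by (simp add: p_def)
    have ReH: "Re (H (p t)) \<ge> 3/8 * exp t" if t: "0 \<le> t" "t \<le> Re u" for t
    proof -
      have "Re (exp (p t)) = exp t * cos (Im u)" by (simp add: p_def Re_exp)
      also have "\<dots> \<ge> exp t * (1/2)" using cos by (intro mult_left_mono) auto
      finally show ?thesis
        using Hexp[OF pV[OF t]] abs_Re_le_cmod[of "H (p t) - exp (p t)"] by (simp add: p_def)
    qed
    \<comment> \<open>Along the horizontal leg \<open>\<bar>F'\<bar> \<le> M exp (- 3/8 e\<^sup>t) \<le> M exp (- 3/8 t)\<close>, which has a bounded integral.\<close>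
    have leg: "norm (F (p (Re u)) - F (p 0)) \<le> - (8/3 * M * exp (- 3/8 * Re u)) - - (8/3 * M * exp (- 3/8 * 0))"
    proof (rule bound_along_path[OF x, where f = F and g = p and d = 1])
      show "(F has_field_derivative \<zeta>' (p t) * exp (- H (p t))) (at (p t))" if "0 \<le> t" "t \<le> Re u" for t
        using F pV that by blast
      show "(p has_vector_derivative 1) (at t)" for t
        unfolding p_def by (auto intro!: derivative_eq_intros)
      show "((\<lambda>t. - (8/3 * M * exp (- 3/8 * t))) has_real_derivative M * exp (- 3/8 * t)) (at t)" for t
        by (auto intro!: derivative_eq_intros)
      show "norm (1 * (\<zeta>' (p t) * exp (- H (p t)))) \<le> M * exp (- 3/8 * t)" if t: "0 \<le> t" "t \<le> Re u" for t
      proof -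
        have "t \<le> exp t" using exp_ge_add_one_self[of t] by linarith
        then have "norm (exp (- H (p t))) \<le> exp (- 3/8 * t)"
          using ReH[OF t] by (simp add: norm_exp_eq_Re)
        then show ?thesis
          using \<zeta>_bnd[OF pV[OF t]] M by (simp add: norm_mult mult_mono)
      qed
    qed
    have "0 \<le> 8/3 * M * exp (- 3/8 * Re u)" using M by simp
    moreover have "exp (- 3/8 * 0 :: real) = 1" by simp
    ultimately have "norm (F u - F (p 0)) \<le> 8/3 * M"
      using leg unfolding pu by simp
    moreover have "norm (F (p 0) - \<zeta> (p 0) - L') \<le> 4 * M * exp 2"
      using L'[of "p 0"] pV[of 0] x by (simp add: p_def mult_ac)
    ultimately have "norm (\<zeta> (p 0)) \<le> norm (F u) + 8/3 * M + 4 * M * exp 2 + norm L'"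
      by norm
    then have F1: "norm (F u) \<ge> 1" using big by (simp add: C_def p_def)
    have "\<phi> u = F u * exp (H u)" by (simp add: F_def exp_minus field_simps)
    then have "norm (\<phi> u) = norm (F u) * exp (Re (H u))" by (simp add: norm_mult norm_exp_eq_Re)
    also have "\<dots> \<ge> 1 * exp (3/8 * exp (Re u))"
      using F1 ReH[of "Re u"] x pu by (intro mult_mono) auto
    finally show "norm (\<phi> u) \<ge> exp (3/8 * exp (Re u))" by simp
  qed
qed simp

section \<open>The coordinate that straightens the coefficient\<close>

lemma poly_asymptotic_lead_coeff:
  fixes p :: "'a :: real_normed_field poly"
  shows "((\<lambda>z. poly p z / z ^ degree p) \<longlongrightarrow> lead_coeff p) at_infinity"
proof -
  have "((\<lambda>z. poly (reflect_poly p) (inverse z)) \<longlongrightarrow> poly (reflect_poly p) 0) at_infinity"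
    by (intro tendsto_intros tendsto_inverse_0)
  then have "((\<lambda>z. poly (reflect_poly p) (inverse z)) \<longlongrightarrow> lead_coeff p) at_infinity"
    by simp
  then show ?thesis
  proof (rule Lim_transform_eventually)
    have "\<forall>\<^sub>F z :: 'a in at_infinity. z \<noteq> 0"
      unfolding eventually_at_infinity by (intro exI[of _ 1]) auto
    then show "\<forall>\<^sub>F z in at_infinity. poly (reflect_poly p) (inverse z) = poly p z / z ^ degree p"
      by eventually_elim (simp add: poly_reflect_poly_nz field_simps)
  qed
qed

text \<open>The map \<open>\<zeta>\<close> expresses \<open>z\<close> in terms of \<open>u\<close>, where \<open>u = w + g w\<close> and \<open>w = z\<^sup>n\<close>. The branch
\<open>z = exp (Ln w / n)\<close> takes the upper half of the \<open>w\<close>-plane to the sector \<open>0 < arg z < \<pi>/n\<close>. The estimate for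
\<open>\<bar>u\<bar>\<close> serves to make \<open>\<bar>\<zeta> u\<bar>\<close> large.\<close>

lemma straightening:
  fixes n :: nat and a :: "nat \<Rightarrow> complex" and P h :: "complex \<Rightarrow> complex" and p q :: "complex poly"
    and R \<eta> :: real
  assumes n: "n \<ge> 1"
    and P: "P = (\<lambda>z. z ^ n + (\<Sum>k<n - 1. a k * z ^ k))"
    and pq: "p \<noteq> 0" "q \<noteq> 0"
    and h: "h = (\<lambda>z. poly p z / poly q z * exp (P z))"
    and \<eta>: "0 < \<eta>" "\<eta> \<le> 1/64"
  obtains A K g \<zeta> \<zeta>' where "A \<ge> 0" "K \<ge> 0"
    and "\<And>w v :: complex. Im w > K \<Longrightarrow> Im v > K \<Longrightarrow> norm (g w - g v) \<le> \<eta> * norm (w - v)"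
    and "\<And>w :: complex. Im w > K \<Longrightarrow> norm (g w) \<le> A + \<eta> * norm w"
    and "\<And>w :: complex. Im w > K \<Longrightarrow> \<zeta> (w + g w) = exp (Ln w / of_nat n)"
    and "\<And>u. u \<in> tilted_half_plane (K + 2 * A) (2 * \<eta>) \<Longrightarrow> (\<zeta> has_field_derivative \<zeta>' u) (at u)"
    and "\<And>u. u \<in> tilted_half_plane (K + 2 * A) (2 * \<eta>) \<Longrightarrow> norm (\<zeta>' u) \<le> 2"
    and "\<And>u. u \<in> tilted_half_plane (K + 2 * A) (2 * \<eta>) \<Longrightarrow> norm (\<zeta> u) > R"
    and "\<And>u. u \<in> tilted_half_plane (K + 2 * A) (2 * \<eta>) \<Longrightarrow> norm u \<le> A + 2 * norm (\<zeta> u) ^ n"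
    and "(\<lambda>u. h (\<zeta> u) * \<zeta>' u) holomorphic_on tilted_half_plane (K + 2 * A) (2 * \<eta>)"
    and "\<And>u. u \<in> tilted_half_plane (K + 2 * A) (2 * \<eta>) \<Longrightarrow>
           norm (h (\<zeta> u) * \<zeta>' u - exp u) \<le> exp (Re u) / 16"
proof -
  define s :: "complex \<Rightarrow> complex" where "s w = exp (Ln w / of_nat n)" for w
  have s_pow: "s w ^ k = exp (of_nat k * (Ln w / of_nat n))" for w k
    unfolding s_def exp_of_nat_mult ..
  have s_n: "s w ^ n = w" if "w \<noteq> 0" for w using that n by (simp add: s_pow)
  have s_nz: "s w \<noteq> 0" for w by (simp add: s_def)
  define c where "c = lead_coeff p / lead_coeff q"
  have c: "c \<noteq> 0" using pq by (simp add: c_def)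
  define \<mu> where "\<mu> = (of_nat (degree p) - of_nat (degree q) - of_nat (n - 1)) / (of_nat n :: complex)"
  define Q where "Q z = poly p z / poly q z * z ^ degree q / (c * z ^ degree p)" for z
  have "((\<lambda>z. (poly p z / z ^ degree p) / (poly q z / z ^ degree q) / c) \<longlongrightarrow> lead_coeff p / lead_coeff q / c) at_infinity"
    using pq c by (intro tendsto_intros poly_asymptotic_lead_coeff) auto
  then have "(Q \<longlongrightarrow> 1) at_infinity"
    using pq unfolding c_def Q_def by (simp add: field_simps)
  then have "\<forall>\<^sub>F z in at_infinity. dist (Q z) 1 < \<eta>" using \<eta>(1) by (rule tendstoD)
  then obtain \<rho>Q where \<rho>Q: "\<And>z. norm z \<ge> \<rho>Q \<Longrightarrow> norm (Q z - 1) < \<eta>"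
    unfolding eventually_at_infinity dist_norm by blast
  \<comment> \<open>With \<open>S z\<close> asymptotic to \<open>c z\<^bsup>deg p - deg q\<^esup>\<close>, the last two terms form a logarithm of \<open>c z\<^bsup>deg p - deg q\<^esup> / (n z\<^bsup>n-1\<^esup>)\<close>.\<close>
  define g where "g w = (\<Sum>k<n - 1. a k * s w ^ k) + (Ln (c / of_nat n) + \<mu> * Ln w)" for w
  define g' where "g' w = (\<Sum>k<n - 1. a k * (s w ^ k * (of_nat k / (of_nat n * w)))) + \<mu> / w" for w
  define T where "T = (\<Sum>k<n - 1. norm (a k) * real k) + norm \<mu>"
  have T: "T \<ge> 0" by (auto simp: T_def intro!: sum_nonneg add_nonneg_nonneg)
  \<comment> \<open>Chosen so that \<open>T / \<bar>z\<bar>\<close>, which bounds \<open>g'\<close>, and \<open>\<bar>Q z - 1\<bar>\<close> are at most \<open>\<eta>\<close> once \<open>\<bar>z\<bar> > \<rho>\<close>.\<close>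
  define \<rho> where "\<rho> = Max {1, R + 1, T / \<eta>, \<rho>Q}"
  have \<rho>: "\<rho> \<ge> 1" "\<rho> > R" "\<rho> \<ge> T / \<eta>" "\<rho> \<ge> \<rho>Q"
  proof -
    have "x \<le> \<rho>" if "x \<in> {1, R + 1, T / \<eta>, \<rho>Q}" for x using that unfolding \<rho>_def by (intro Max_ge) auto
    from this[of 1] this[of "R + 1"] this[of "T / \<eta>"] this[of \<rho>Q]
    show "\<rho> \<ge> 1" "\<rho> > R" "\<rho> \<ge> T / \<eta>" "\<rho> \<ge> \<rho>Q" by auto
  qed
  define K where "K = \<rho> ^ n"
  have K: "K \<ge> 1" using \<rho>(1) by (simp add: K_def)
  have nz: "w \<noteq> 0" "w \<notin> \<real>\<^sub>\<le>\<^sub>0" if "Im w > K" for w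
    using that K by (auto simp: complex_nonpos_Reals_iff)
  have s_norm: "norm (s w) ^ n = norm w" if "w \<noteq> 0" for w
    using s_n[OF that] by (metis norm_power)
  have s_big: "norm (s w) > \<rho>" if w: "Im w > K" for w
  proof -
    have "\<rho> ^ n < norm (s w) ^ n"
      using s_norm[of w] nz[OF w] w abs_Im_le_cmod[of w] by (simp add: K_def)
    then show ?thesis by (rule power_less_imp_less_base) simp
  qed
  have s_deriv: "(s has_field_derivative s w / (of_nat n * w)) (at w)" if "Im w > K" for w
    unfolding s_def using nz[OF that] n by (auto intro!: derivative_eq_intros simp: field_simps)
  have g_deriv: "(g has_field_derivative g' w) (at w)" if w: "Im w > K" for w
    unfolding g_def g'_def s_pow
  proof (intro DERIV_add DERIV_sum DERIV_cmult)
    show "((\<lambda>w. exp (of_nat k * (Ln w / of_nat n))) has_field_derivative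
        exp (of_nat k * (Ln w / of_nat n)) * (of_nat k / (of_nat n * w))) (at w)" for k
      using nz[OF w] n by (auto intro!: derivative_eq_intros simp: field_simps)
    show "((\<lambda>w. Ln (c / of_nat n) + \<mu> * Ln w) has_field_derivative \<mu> / w) (at w)"
      using nz[OF w] by (auto intro!: derivative_eq_intros simp: field_simps)
  qed
  have g'_bnd: "norm (g' w) \<le> \<eta>" if w: "Im w > K" for w
  proof -
    define r where "r = norm (s w)"
    have r: "r > \<rho>" "r \<ge> 1" "r ^ n = norm w" using s_big[OF w] \<rho>(1) s_norm nz[OF w] by (auto simp: r_def)
    have pow: "r ^ k / norm w \<le> 1 / r" if "k < n" for k
    proof -
      have "r ^ Suc k \<le> r ^ n" using that r by (intro power_increasing) auto
      then show ?thesis using r(1,2) unfolding r(3)[symmetric] by (simp add: field_simps)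
    qed
    have "norm (a k * (s w ^ k * (of_nat k / (of_nat n * w)))) \<le> norm (a k) * real k * (1 / r)"
      if k: "k < n - 1" for k
    proof -
      have "norm (a k * (s w ^ k * (of_nat k / (of_nat n * w)))) = norm (a k) * real k * (r ^ k / norm w) / real n"
        by (simp add: norm_mult norm_divide norm_power r_def mult_ac)
      also have "\<dots> \<le> norm (a k) * real k * (r ^ k / norm w) / 1"
        using n r(2) by (intro divide_left_mono mult_nonneg_nonneg divide_nonneg_nonneg) auto
      also have "\<dots> \<le> norm (a k) * real k * (1 / r) / 1"
        using pow[of k] k by (intro divide_right_mono mult_left_mono) auto
      finally show ?thesis by simp
    qed
    then have "norm (\<Sum>k<n - 1. a k * (s w ^ k * (of_nat k / (of_nat n * w)))) \<le> (\<Sum>k<n - 1. norm (a k) * real k * (1 / r))"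
      by (intro sum_norm_le) auto
    moreover have "norm (\<mu> / w) \<le> norm \<mu> * (1 / r)"
      using pow[of 0] n mult_left_mono[of "1 / norm w" "1 / r" "norm \<mu>"] by (simp add: norm_divide)
    ultimately have "norm (g' w) \<le> (\<Sum>k<n - 1. norm (a k) * real k * (1 / r)) + norm \<mu> * (1 / r)"
      unfolding g'_def by (rule norm_triangle_mono)
    also have "\<dots> = T / r" by (simp add: T_def sum_divide_distrib add_divide_distrib)
    also have "\<dots> \<le> \<eta>"
    proof -
      have "T \<le> \<rho> * \<eta>" using \<rho>(3) \<eta>(1) by (simp add: field_simps)
      also have "\<dots> \<le> r * \<eta>" using r \<eta> by (intro mult_right_mono) auto
      finally show ?thesis using r by (simp add: field_simps)
    qed
    finally show ?thesis .
  qed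
  have \<eta>2: "\<eta> < 1/2" using \<eta> by simp
  obtain A \<kappa> where A: "A \<ge> 0"
    and lip: "\<And>w v. Im w > K \<Longrightarrow> Im v > K \<Longrightarrow> norm (g w - g v) \<le> \<eta> * norm (w - v)"
    and gA: "\<And>w. Im w > K \<Longrightarrow> norm (g w) \<le> A + \<eta> * norm w"
    and \<kappa>_Im: "\<And>u. Im u > K + 2 * A + 2 * \<eta> * norm u \<Longrightarrow> Im (\<kappa> u) > K"
    and \<kappa>_eq: "\<And>u. Im u > K + 2 * A + 2 * \<eta> * norm u \<Longrightarrow> \<kappa> u + g (\<kappa> u) = u"
    and \<kappa>_deriv: "\<And>u. Im u > K + 2 * A + 2 * \<eta> * norm u \<Longrightarrow>
           (\<kappa> has_field_derivative 1 / (1 + g' (\<kappa> u))) (at u)"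
    and \<kappa>_inv: "\<And>w. Im w > K \<Longrightarrow> \<kappa> (w + g w) = w"
    using near_identity_inverse[OF g_deriv g'_bnd \<eta>(1) \<eta>2] by blast
  let ?V = "tilted_half_plane (K + 2 * A) (2 * \<eta>)"
  note Vdef = tilted_half_plane_def[of "K + 2 * A" "2 * \<eta>"]
  define \<zeta> where "\<zeta> u = s (\<kappa> u)" for u
  define \<zeta>' where "\<zeta>' u = s (\<kappa> u) / (of_nat n * \<kappa> u) * (1 / (1 + g' (\<kappa> u)))" for u
  have den: "norm (1 + g' w) \<ge> 1 - \<eta>" if "Im w > K" for w
    using g'_bnd[OF that] norm_triangle_ineq2[of 1 "- g' w"] by simp
  have \<zeta>_deriv: "(\<zeta> has_field_derivative \<zeta>' u) (at u)" if u: "u \<in> ?V" for u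
    unfolding \<zeta>_def \<zeta>'_def
    by (rule DERIV_chain2[of s]) (use u s_deriv \<kappa>_Im \<kappa>_deriv in \<open>auto simp: Vdef\<close>)
  have s'_eq: "s w / (of_nat n * w) = 1 / (of_nat n * s w ^ (n - 1))" if "Im w > K" for w
  proof -
    have "w = s w * s w ^ (n - 1)" using s_n nz[OF that] n by (metis power_eq_if not_one_le_zero)
    then show ?thesis using s_nz[of w] by (metis divide_self_if mult.left_commute nonzero_divide_mult_cancel_left)
  qed
  have \<zeta>'_bnd: "norm (\<zeta>' u) \<le> 2" if u: "u \<in> ?V" for u
  proof -
    have w: "Im (\<kappa> u) > K" using u \<kappa>_Im by (simp add: Vdef)
    have "norm (s (\<kappa> u)) ^ (n - 1) \<ge> 1" using s_big[OF w] \<rho>(1) by (intro one_le_power) auto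
    then have "1 * 1 \<le> real n * norm (s (\<kappa> u)) ^ (n - 1)" using n by (intro mult_mono) auto
    then have 1: "norm (s (\<kappa> u) / (of_nat n * \<kappa> u)) \<le> 1"
      unfolding s'_eq[OF w] by (simp add: norm_divide norm_mult norm_power)
    have "norm (1 + g' (\<kappa> u)) \<ge> 1/2" using den[OF w] \<eta> by linarith
    then have "norm (1 / (1 + g' (\<kappa> u))) \<le> 2"
      using frac_le[of 1 1 "1/2" "norm (1 + g' (\<kappa> u))"] by (simp add: norm_divide)
    then have "norm (s (\<kappa> u) / (of_nat n * \<kappa> u)) * norm (1 / (1 + g' (\<kappa> u))) \<le> 1 * 2"
      using 1 by (intro mult_mono) auto
    then show ?thesis by (simp only: \<zeta>'_def norm_mult mult_1)
  qed
  have \<zeta>_big: "norm (\<zeta> u) > \<rho>" if "u \<in> ?V" for u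
    using that s_big \<kappa>_Im by (simp add: Vdef \<zeta>_def)
  have q_nz: "poly q (\<zeta> u) \<noteq> 0" if "u \<in> ?V" for u
  proof
    \<comment> \<open>Division by zero would make \<open>Q (\<zeta> u)\<close> zero, but it is close to \<open>1\<close>.\<close>
    assume "poly q (\<zeta> u) = 0"
    then have "Q (\<zeta> u) = 0" by (simp add: Q_def)
    then show False using \<rho>Q[of "\<zeta> u"] \<zeta>_big[OF that] \<rho>(4) \<eta> by simp
  qed
  show ?thesis
  proof (rule that[OF A _ lip gA])
    show "K \<ge> 0" using K by simp
    show "\<zeta> (w + g w) = exp (Ln w / of_nat n)" if "Im w > K" for w
      using \<kappa>_inv[OF that] by (simp add: \<zeta>_def s_def)
    show "(\<zeta> has_field_derivative \<zeta>' u) (at u)" if "u \<in> ?V" for u using \<zeta>_deriv that .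
    show "norm (\<zeta>' u) \<le> 2" if "u \<in> ?V" for u using \<zeta>'_bnd that .
    show "norm (\<zeta> u) > R" if "u \<in> ?V" for u using \<zeta>_big[OF that] \<rho>(2) by simp
    show "norm u \<le> A + 2 * norm (\<zeta> u) ^ n" if u: "u \<in> ?V" for u
    proof -
      have w: "Im (\<kappa> u) > K" using u \<kappa>_Im by (simp add: Vdef)
      have "norm u \<le> norm (\<kappa> u) + norm (g (\<kappa> u))"
        using \<kappa>_eq[of u] u norm_triangle_ineq[of "\<kappa> u" "g (\<kappa> u)"] by (simp add: Vdef)
      also have "\<dots> \<le> norm (\<kappa> u) + (A + 1 * norm (\<kappa> u))"
        using gA[OF w] \<eta> mult_right_mono[of \<eta> 1 "norm (\<kappa> u)"] by simp
      finally show ?thesis using s_norm nz[OF w] by (simp add: \<zeta>_def)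
    qed
    have hol: "\<zeta> holomorphic_on ?V"
      using \<zeta>_deriv by (intro holomorphic_onI) (auto intro: has_field_derivative_at_within simp: field_differentiable_def)
    have "deriv \<zeta> holomorphic_on ?V" using hol open_tilted_half_plane by (rule holomorphic_deriv)
    then have hol': "\<zeta>' holomorphic_on ?V"
      by (rule holomorphic_transform) (use \<zeta>_deriv DERIV_imp_deriv in blast)
    show "(\<lambda>u. h (\<zeta> u) * \<zeta>' u) holomorphic_on ?V"
      unfolding h P by (intro holomorphic_intros hol hol' holomorphic_on_compose[unfolded o_def, OF hol]) (use q_nz in auto)
    show "norm (h (\<zeta> u) * \<zeta>' u - exp u) \<le> exp (Re u) / 16" if u: "u \<in> ?V" for u
    proof -
      define w where "w = \<kappa> u"
      have w: "Im w > K" using u \<kappa>_Im by (simp add: Vdef w_def)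
      define E where "E = exp (\<mu> * Ln w)"
      have "E \<noteq> 0" by (simp add: E_def)
      have "\<mu> * Ln w + of_nat (degree q) * (Ln w / of_nat n) + of_nat (n - 1) * (Ln w / of_nat n)
          = of_nat (degree p) * (Ln w / of_nat n)"
        using n by (simp add: \<mu>_def field_simps)
      then have E: "E * s w ^ degree q * s w ^ (n - 1) = s w ^ degree p"
        unfolding E_def s_pow by (simp flip: exp_add)
      have "exp u = exp (w + g w)" using \<kappa>_eq[of u] u by (simp add: Vdef w_def)
      also have "w + g w = P (s w) + (Ln (c / of_nat n) + \<mu> * Ln w)"
        using s_n nz[OF w] by (simp add: P g_def)
      finally have exp_u: "exp u = exp (P (s w)) * (c / of_nat n * E)"
        using c n by (simp add: exp_add E_def)
      \<comment> \<open>Since \<open>e\<^sup>u = c e\<^sup>P E / n\<close>, the quotient of \<open>h dz/dw\<close> and \<open>e\<^sup>u\<close> is exactly \<open>Q\<close>.\<close>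
      have eq: "h (s w) * (s w / (of_nat n * w)) = exp u * Q (s w)"
        unfolding s'_eq[OF w] exp_u using c n s_nz[of w] \<open>E \<noteq> 0\<close>
        by (simp add: h Q_def field_simps flip: E)
      have "h (\<zeta> u) * \<zeta>' u = h (s w) * (s w / (of_nat n * w)) * (1 / (1 + g' w))"
        by (simp only: \<zeta>_def \<zeta>'_def w_def mult.assoc)
      then have "h (\<zeta> u) * \<zeta>' u = exp u * Q (s w) / (1 + g' w)"
        unfolding eq by simp
      moreover have g1: "1 + g' w \<noteq> 0" using den[OF w] \<eta> by auto
      ultimately have "h (\<zeta> u) * \<zeta>' u - exp u = exp u * ((Q (s w) - 1 - g' w) / (1 + g' w))"
        by (simp add: field_simps)
      then have "norm (h (\<zeta> u) * \<zeta>' u - exp u) = exp (Re u) * (norm (Q (s w) - 1 - g' w) / norm (1 + g' w))"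
        by (simp add: norm_mult norm_divide)
      also have "\<dots> \<le> exp (Re u) * ((2 * \<eta>) / (1 - \<eta>))"
      proof (intro mult_left_mono frac_le)
        have "norm (Q (s w) - 1) \<le> \<eta>" using \<rho>Q[of "s w"] s_big[OF w] \<rho>(4) by simp
        then show "norm (Q (s w) - 1 - g' w) \<le> 2 * \<eta>"
          using g'_bnd[OF w] norm_triangle_ineq4[of "Q (s w) - 1" "g' w"] by simp
      qed (use den[OF w] \<eta> in auto)
      also have "\<dots> \<le> exp (Re u) * (1 / 16)"
        using \<eta> by (intro mult_left_mono) (auto simp: field_simps)
      finally show ?thesis by simp
    qed
  qed
qed

section \<open>Intervals of infinite logarithmic measure\<close>

lemma log_measure_intervals_infinite:
  fixes r :: "nat \<Rightarrow> real"
  assumes pos: "\<And>k. r k > 0" and mono: "strict_mono r" and "D > 0"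
    and gap: "\<And>l. (r (2 * l + 1) - r (2 * l)) / r (2 * l + 1) \<ge> D / (real l + 1)"
  shows "log_measure (\<Union>l. {r (2 * l)..r (2 * l + 1)}) = \<infinity>"
proof -
  let ?I = "\<lambda>l. {r (2 * l)..r (2 * l + 1)}"
  have disj: "disjoint_family ?I"
    unfolding disjoint_family_on_def
  proof (intro ballI impI)
    have *: "?I i \<inter> ?I j = {}" if "i < j" for i j :: nat
    proof -
      have "r (2 * i + 1) < r (2 * j)"
        using that by (intro strict_monoD[OF mono]) auto
      then show ?thesis by auto
    qed
    show "?I i \<inter> ?I j = {}" if "i \<noteq> j" for i j :: nat
      using that *[of i j] *[of j i] by (metis Int_commute linorder_neqE_nat)
  qed
  have single: "(\<integral>\<^sup>+ x \<in> ?I l. ennreal (1 / x) \<partial>lborel) \<ge> ennreal (D / (real l + 1))" for l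
  proof -
    have le: "r (2 * l) \<le> r (2 * l + 1)"
      by (intro monoD[OF strict_mono_mono[OF mono]]) simp
    have "ennreal (D / (real l + 1)) \<le> ennreal (1 / r (2 * l + 1) * (r (2 * l + 1) - r (2 * l)))"
      using gap[of l] by (intro ennreal_leI) simp
    also have "\<dots> = ennreal (1 / r (2 * l + 1)) * emeasure lborel (?I l)"
      using le pos[of "2 * l + 1"] by (subst ennreal_mult) auto
    also have "\<dots> = (\<integral>\<^sup>+ x \<in> ?I l. ennreal (1 / r (2 * l + 1)) \<partial>lborel)"
      by (subst nn_integral_cmult_indicator) auto
    also have "\<dots> \<le> (\<integral>\<^sup>+ x \<in> ?I l. ennreal (1 / x) \<partial>lborel)"
    proof (rule nn_integral_mono)
      fix x
      show "ennreal (1 / r (2 * l + 1)) * indicator (?I l) x \<le> ennreal (1 / x) * indicator (?I l) x"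
        using pos[of "2 * l"] by (cases "x \<in> ?I l") (auto intro!: ennreal_leI divide_left_mono)
    qed
    finally show ?thesis .
  qed
  have "(\<Sum>l. ennreal (D / (real l + 1))) = \<infinity>"
  proof (rule ccontr)
    assume "\<not> ?thesis"
    then have "summable (\<lambda>l. D / (real l + 1))"
      using \<open>D > 0\<close> by (intro summable_suminf_not_top) auto
    then have "summable (\<lambda>l. inverse D * (D / (real l + 1)))" by (rule summable_mult)
    then have "summable (\<lambda>l. inverse (real (Suc l)))"
      using \<open>D > 0\<close> by (simp add: field_simps)
    then show False
      using not_summable_harmonic[where 'a = real] summable_Suc_iff[of "\<lambda>n. inverse (real n)"] by blast
  qed
  moreover have "(\<Sum>l. ennreal (D / (real l + 1))) \<le> (\<Sum>l. \<integral>\<^sup>+ x \<in> ?I l. ennreal (1 / x) \<partial>lborel)"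
    by (intro suminf_le single summableI)
  moreover have "log_measure (\<Union>l. ?I l) = (\<Sum>l. \<integral>\<^sup>+ x \<in> ?I l. ennreal (1 / x) \<partial>lborel)"
    unfolding log_measure_def by (rule nn_integral_disjoint_family[OF _ _ disj]) auto
  ultimately show ?thesis by (metis infinity_ennreal_def top.extremum_unique)
qed

lemma cos_ge_half_near_period:
  assumes "2 * pi * real m - pi / 3 \<le> y" "y \<le> 2 * pi * real m + pi / 3"
  shows "cos y \<ge> 1 / 2"
proof -
  define d where "d = y - 2 * pi * real m"
  have "cos y = cos (d + 2 * real m * pi)" by (simp add: d_def)
  also have "\<dots> = cos \<bar>d\<bar>" by (simp only: cos_add cos_2npi sin_2npi) simp
  finally have cos_d: "cos y = cos \<bar>d\<bar>" .
  have "\<bar>d\<bar> \<le> pi / 3" using assms unfolding d_def abs_le_iff by linarith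
  then have "cos (pi / 3) \<le> cos \<bar>d\<bar>" by (intro cos_monotone_0_pi_le) auto
  then show ?thesis by (simp add: cos_60 cos_d)
qed

text \<open>Because \<open>Y\<close> grows at a rate between \<open>\<sigma>\<close> and \<open>2\<close>, the set of all \<open>t \<ge> T\<close> with \<open>cos (Y t) \<ge> 1/2\<close> contains
infinitely many intervals of length at least \<open>\<pi>/3\<close>, the \<open>l\<close>-th of which lies below a constant times \<open>l + 1\<close>. Passing to \<open>x\<close> with \<open>t = x\<^sup>n\<close> divides the logarithmic
length by \<open>n\<close>, which Bernoulli's inequality expresses for the relative length used here.\<close>

lemma intervals_of_large_cosine:
  fixes Y :: "real \<Rightarrow> real" and n :: nat
  assumes n: "n \<ge> 1" and T: "T > 0" and \<sigma>: "\<sigma> > 0"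
    and lower: "\<And>t t'. T \<le> t \<Longrightarrow> t \<le> t' \<Longrightarrow> \<sigma> * (t' - t) \<le> Y t' - Y t"
    and upper: "\<And>t t'. T \<le> t \<Longrightarrow> t \<le> t' \<Longrightarrow> Y t' - Y t \<le> 2 * (t' - t)"
  obtains r :: "nat \<Rightarrow> real" where "\<And>k. r k > 0" "\<And>k. r k ^ n \<ge> T"
    and "\<And>l x. x \<in> {r (2 * l)..r (2 * l + 1)} \<Longrightarrow> cos (Y (x ^ n)) \<ge> 1/2"
    and "log_measure (\<Union>l. {r (2 * l)..r (2 * l + 1)}) = \<infinity>"
proof -
  have Ymono: "Y t \<le> Y t'" if "T \<le> t" "t \<le> t'" for t t'
  proof -
    have "0 \<le> \<sigma> * (t' - t)" using \<sigma> that by simp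
    then show ?thesis using lower[OF that] by linarith
  qed
  have cont: "continuous_on {T..} Y"
  proof (rule lipschitz_on_continuous_on[of 2])
    show "2-lipschitz_on {T..} Y"
    proof (rule lipschitz_onI)
      fix t t' assume "t \<in> {T..}" "t' \<in> {T..}"
      then show "dist (Y t) (Y t') \<le> 2 * dist t t'"
        using upper[of t t'] upper[of t' t] Ymono[of t t'] Ymono[of t' t]
        by (cases "t \<le> t'") (auto simp: dist_real_def)
    qed simp
  qed
  obtain N :: nat where N: "real N > (Y T + pi / 3) / (2 * pi)" using reals_Archimedean2 by blast
  \<comment> \<open>The end points of the intervals of length \<open>2\<pi>/3\<close> around the multiples \<open>2\<pi> (N + l)\<close>, listed in increasing order.\<close>
  define v where "v k = 2 * pi * real (N + k div 2) + (if even k then - pi / 3 else pi / 3)" for k :: nat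
  have v0: "v 0 \<ge> Y T" using N by (simp add: v_def field_simps)
  have v_even: "v (2 * l) = 2 * pi * real (N + l) - pi / 3" and v_odd: "v (2 * l + 1) = 2 * pi * real (N + l) + pi / 3" for l
    by (simp_all add: v_def)
  have v_Suc: "v k < v (Suc k)" for k
  proof (cases "even k")
    case True
    then show ?thesis by (simp add: v_def)
  next
    case False
    then obtain l where l: "k = 2 * l + 1" by (elim oddE)
    have "v (Suc k) = v (2 * (l + 1))" by (simp add: l)
    then show ?thesis unfolding l v_odd v_even using pi_gt_zero by (simp add: algebra_simps)
  qed
  have v_mono: "strict_mono v" using v_Suc by (simp add: strict_mono_Suc_iff)
  have "\<exists>t\<ge>T. Y t = v k \<and> t \<le> T + (v k - Y T) / \<sigma>" for k
  proof -
    have vk: "v k \<ge> Y T" using v0 strict_mono_less_eq[OF v_mono, of 0 k] by simp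
    define b where "b = T + (v k - Y T) / \<sigma>"
    have b: "b \<ge> T" using vk \<sigma> by (simp add: b_def)
    have "v k \<le> Y b" using lower[OF _ b] \<sigma> by (simp add: b_def)
    then have "\<exists>t\<ge>T. t \<le> b \<and> Y t = v k"
      using vk b by (intro IVT' continuous_on_subset[OF cont]) auto
    then show ?thesis by (auto simp: b_def)
  qed
  then obtain \<tau> where \<tau>: "\<And>k. \<tau> k \<ge> T" "\<And>k. Y (\<tau> k) = v k" "\<And>k. \<tau> k \<le> T + (v k - Y T) / \<sigma>"
    by metis
  have \<tau>_Suc: "\<tau> k < \<tau> (Suc k)" for k
  proof (rule ccontr)
    assume "\<not> \<tau> k < \<tau> (Suc k)"
    then have "Y (\<tau> (Suc k)) \<le> Y (\<tau> k)" using Ymono \<tau>(1) by simp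
    then show False using v_Suc[of k] \<tau>(2) by simp
  qed
  have \<tau>pos: "\<tau> k > 0" for k using \<tau>(1)[of k] T by linarith
  define r where "r k = root n (\<tau> k)" for k
  have rpos: "r k > 0" for k using \<tau>pos n by (simp add: r_def)
  have rn: "r k ^ n = \<tau> k" for k using \<tau>pos[of k] n by (simp add: r_def)
  have r_mono: "strict_mono r"
    unfolding strict_mono_Suc_iff r_def using \<tau>_Suc n by (intro allI real_root_less_mono) auto
  define D where "D = T + (2 * pi * (real N + 1) + \<bar>Y T\<bar>) / \<sigma>"
  have D: "D > 0" using T \<sigma> by (simp add: D_def add_pos_nonneg)
  have gap: "1 / (real n * D) / (real l + 1) \<le> (r (2 * l + 1) - r (2 * l)) / r (2 * l + 1)" for l
  proof -
    define q where "q = r (2 * l) / r (2 * l + 1)"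
    have "v (2 * l + 1) - v (2 * l) \<le> 2 * (\<tau> (2 * l + 1) - \<tau> (2 * l))"
      using upper[of "\<tau> (2 * l)" "\<tau> (2 * l + 1)"] \<tau> \<tau>_Suc[of "2 * l"] by simp
    moreover have "v (2 * l + 1) - v (2 * l) = 2 * (pi / 3)" unfolding v_even v_odd by simp
    ultimately have "pi / 3 \<le> \<tau> (2 * l + 1) - \<tau> (2 * l)"
      by (simp only: mult_le_cancel_left_pos zero_less_numeral)
    moreover have "1 \<le> pi / 3" using pi_gt3 by simp
    ultimately have 1: "1 \<le> \<tau> (2 * l + 1) - \<tau> (2 * l)" by (rule order_trans[rotated])
    have "v (2 * l + 1) - Y T \<le> (2 * pi * (real N + 1) + \<bar>Y T\<bar>) * (real l + 1)"
    proof -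
      have "2 * pi * real (N + l) + pi / 3 \<le> 2 * pi * (real N + 1) * (real l + 1)"
        using pi_gt_zero by (simp add: algebra_simps)
      moreover have "- Y T \<le> \<bar>Y T\<bar> * (real l + 1)"
        using mult_left_mono[of 1 "real l + 1" "\<bar>Y T\<bar>"] by simp
      ultimately show ?thesis
        unfolding v_odd distrib_right[of _ _ "real l + 1"] by linarith
    qed
    then have "(v (2 * l + 1) - Y T) / \<sigma> \<le> (2 * pi * (real N + 1) + \<bar>Y T\<bar>) * (real l + 1) / \<sigma>"
      using \<sigma> by (intro divide_right_mono) auto
    moreover have "T \<le> T * (real l + 1)" using T by simp
    ultimately have 2: "\<tau> (2 * l + 1) \<le> D * (real l + 1)"
      using \<tau>(3)[of "2 * l + 1"] by (simp add: D_def algebra_simps)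
    have q: "q \<ge> 0" using rpos by (simp add: q_def less_imp_le)
    have "1 / (D * (real l + 1)) \<le> 1 / \<tau> (2 * l + 1)"
      using 2 \<tau>pos D by (intro divide_left_mono mult_pos_pos) auto
    also have "\<dots> \<le> (\<tau> (2 * l + 1) - \<tau> (2 * l)) / \<tau> (2 * l + 1)"
      using 1 \<tau>pos by (intro divide_right_mono) (auto simp: less_imp_le)
    also have "\<dots> = 1 - q ^ n"
      using \<tau>pos[of "2 * l + 1"] by (simp add: q_def power_divide rn diff_divide_distrib)
    also have "\<dots> \<le> real n * (1 - q)"
      using Bernoulli_inequality[of "q - 1" n] q by (simp add: algebra_simps)
    also have "1 - q = (r (2 * l + 1) - r (2 * l)) / r (2 * l + 1)"
      using rpos[of "2 * l + 1"] by (simp add: q_def diff_divide_distrib)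
    finally have "1 / (D * (real l + 1)) / real n \<le> (r (2 * l + 1) - r (2 * l)) / r (2 * l + 1)"
      using n by (subst pos_divide_le_eq) (auto simp: mult.commute)
    then show ?thesis by (simp add: mult_ac)
  qed
  show ?thesis
  proof (rule that)
    show "r k > 0" for k by (rule rpos)
    show "r k ^ n \<ge> T" for k using \<tau> by (simp add: rn)
    show "cos (Y (x ^ n)) \<ge> 1/2" if x: "x \<in> {r (2 * l)..r (2 * l + 1)}" for l x
    proof -
      have x0: "x \<ge> 0" using x rpos[of "2 * l"] by simp
      have "\<tau> (2 * l) \<le> x ^ n" "x ^ n \<le> \<tau> (2 * l + 1)"
        unfolding rn[symmetric] using x x0 rpos[of "2 * l"] by (auto intro!: power_mono)
      then have "v (2 * l) \<le> Y (x ^ n)" "Y (x ^ n) \<le> v (2 * l + 1)"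
        unfolding \<tau>(2)[symmetric] using \<tau>(1)[of "2 * l"] by (auto intro!: Ymono)
      then show ?thesis using cos_ge_half_near_period[of "N + l"] unfolding v_even v_odd by blast
    qed
    show "log_measure (\<Union>l. {r (2 * l)..r (2 * l + 1)}) = \<infinity>"
      using gap n D by (intro log_measure_intervals_infinite[OF rpos r_mono, of "1 / (real n * D)"]) auto
  qed
qed

section \<open>Growth along the ray\<close>

lemma eventually_double_exp_dominates:
  fixes a b k A :: real
  assumes "0 < a" "a < b" "0 < k"
  shows "\<forall>\<^sub>F t in at_top. t * exp (exp (a * t)) \<le> exp (k * exp (b * t - A))"
  using assms by real_asymp

theorem theorem1p1:
  fixes n :: nat and a :: "nat \<Rightarrow> complex" and P S h :: "complex \<Rightarrow> complex"
    and R \<theta> :: real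
  assumes "n \<ge> 1"
    and "P = (\<lambda>z. z ^ n + (\<Sum>k<n - 1. a k * z ^ k))"
    and "rational_function S" and "S \<noteq> (\<lambda>z. 0)"
    and "h = (\<lambda>z. S z * exp (P z))"
    and "R > 0" and "\<And>z. is_pole S z \<Longrightarrow> z \<in> ball 0 R"
    and "0 < \<theta>" and "\<theta> < pi / (2 * real n)"
  shows "\<forall>\<^sub>F \<epsilon> :: real in at_right 0. \<forall>f. solution_outside R h f \<longrightarrow>
    (\<exists>r :: nat \<Rightarrow> real. (\<forall>k. r k > R) \<and>
      (let E = (\<Union>l. {r (2 * l)..r (2 * l + 1)}) in
        log_measure E = \<infinity> \<and>
        (\<forall>x\<in>E. norm (f (of_real x * exp (\<i> * of_real \<theta>))) \<ge>
           (1 - \<epsilon>) * (root n (sin (real n * \<theta>)) / real n) * x *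
             exp (exp ((1 - \<epsilon>) * x ^ n * cos (real n * \<theta>)) * sin \<epsilon>))))"
proof -
  note n = \<open>n \<ge> 1\<close>
  define s0 c0 where "s0 = sin (real n * \<theta>)" and "c0 = cos (real n * \<theta>)"
  have ang: "0 < real n * \<theta>" "real n * \<theta> < pi / 2"
    using assms(8,9) n by (auto simp: field_simps)
  have s0: "0 < s0" "s0 \<le> 1" and c0: "0 < c0"
    using ang by (auto simp: s0_def c0_def intro!: sin_gt_zero cos_gt_zero)
  obtain p q where q: "q \<noteq> 0" and S: "S = (\<lambda>z. poly p z / poly q z)"
    using assms(3) by (auto simp: rational_function_def)
  have p: "p \<noteq> 0" using assms(4) by (auto simp: S)
  have h: "h = (\<lambda>z. poly p z / poly q z * exp (P z))" by (simp add: assms(5) S)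
  have main: "\<exists>r :: nat \<Rightarrow> real. (\<forall>k. r k > R) \<and>
      (let E = (\<Union>l. {r (2 * l)..r (2 * l + 1)}) in
        log_measure E = \<infinity> \<and>
        (\<forall>x\<in>E. norm (f (of_real x * exp (\<i> * of_real \<theta>))) \<ge>
           (1 - \<epsilon>) * (root n s0 / real n) * x * exp (exp ((1 - \<epsilon>) * x ^ n * c0) * sin \<epsilon>)))"
    if \<epsilon>: "0 < \<epsilon>" "\<epsilon> < 1" and f: "solution_outside R h f" for \<epsilon> :: real and f
  proof -
    \<comment> \<open>The three bounds serve, in turn, the change of coordinate, keeping the ray inside the region, and losing at most \<open>\<epsilon>/4\<close> in \<open>Re u\<close>.\<close>
    define \<eta> where "\<eta> = min (1/64) (min (s0 / 8) (\<epsilon> * c0 / 4))"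
    have \<eta>: "0 < \<eta>" "\<eta> \<le> 1/64" "\<eta> \<le> s0 / 8" "\<eta> \<le> \<epsilon> * c0 / 4"
      using \<epsilon> s0 c0 unfolding \<eta>_def by auto
    obtain A K g \<zeta> \<zeta>' where A: "A \<ge> 0" and K: "K \<ge> 0"
      and lip: "\<And>w v :: complex. Im w > K \<Longrightarrow> Im v > K \<Longrightarrow> norm (g w - g v) \<le> \<eta> * norm (w - v)"
      and gA: "\<And>w :: complex. Im w > K \<Longrightarrow> norm (g w) \<le> A + \<eta> * norm w"
      and \<zeta>_inv: "\<And>w :: complex. Im w > K \<Longrightarrow> \<zeta> (w + g w) = exp (Ln w / of_nat n)"
      and \<zeta>: "\<And>u. u \<in> tilted_half_plane (K + 2 * A) (2 * \<eta>) \<Longrightarrow> (\<zeta> has_field_derivative \<zeta>' u) (at u)"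
      and \<zeta>'_bnd: "\<And>u. u \<in> tilted_half_plane (K + 2 * A) (2 * \<eta>) \<Longrightarrow> norm (\<zeta>' u) \<le> 2"
      and \<zeta>_R: "\<And>u. u \<in> tilted_half_plane (K + 2 * A) (2 * \<eta>) \<Longrightarrow> norm (\<zeta> u) > R"
      and \<zeta>_big: "\<And>u. u \<in> tilted_half_plane (K + 2 * A) (2 * \<eta>) \<Longrightarrow> norm u \<le> A + 2 * norm (\<zeta> u) ^ n"
      and \<psi>: "(\<lambda>u. h (\<zeta> u) * \<zeta>' u) holomorphic_on tilted_half_plane (K + 2 * A) (2 * \<eta>)"
      and \<psi>_bnd: "\<And>u. u \<in> tilted_half_plane (K + 2 * A) (2 * \<eta>) \<Longrightarrow>
             norm (h (\<zeta> u) * \<zeta>' u - exp u) \<le> exp (Re u) / 16"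
      using straightening[OF n assms(2) p q h \<eta>(1,2), of R] by blast
    define V where "V = tilted_half_plane (K + 2 * A) (2 * \<eta>)"
    have \<phi>: "((\<lambda>u. f (\<zeta> u)) has_field_derivative (h (\<zeta> u) * \<zeta>' u) * f (\<zeta> u) + \<zeta>' u) (at u)" if u: "u \<in> V" for u
    proof -
      have z: "\<zeta> u \<in> - ball 0 R" using \<zeta>_R[of u] u by (simp add: V_def)
      then have "f field_differentiable at (\<zeta> u)"
        using f by (auto simp: solution_outside_def intro: analytic_on_imp_differentiable_at)
      then have "(f has_field_derivative h (\<zeta> u) * f (\<zeta> u) + 1) (at (\<zeta> u))"
        using f z by (metis DERIV_deriv_iff_field_differentiable solution_outside_def)
      from DERIV_chain2[OF this \<zeta>[of u]] u show ?thesis by (simp add: V_def algebra_simps)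
    qed
    have "\<exists>C. \<forall>u\<in>V. Re u \<ge> 0 \<longrightarrow> cos (Im u) \<ge> 1/2 \<longrightarrow> norm (\<zeta> (\<i> * of_real (Im u))) \<ge> C
           \<longrightarrow> norm (f (\<zeta> u)) \<ge> exp (3/8 * exp (Re u))"
    proof (rule growth_in_tracts[where M = 2, OF _ _ _ _ _ _ _ _ \<phi>])
      show "convex V" "open V" unfolding V_def
        using \<eta> by (auto intro: convex_tilted_half_plane open_tilted_half_plane)
      show "u + of_real t * (\<i> - 1) \<in> V" if "u \<in> V" "t \<ge> 0" for u t
        using that \<eta> unfolding V_def by (intro tilted_half_plane_shift) auto
      show "of_real t + \<i> * of_real (Im u) \<in> V" if "u \<in> V" "0 \<le> t" "t \<le> Re u" for u t
        using that \<eta> unfolding V_def by (intro tilted_half_plane_toward_axis) auto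
    qed (use \<zeta> \<zeta>'_bnd \<psi> \<psi>_bnd in \<open>auto simp: V_def\<close>)
    then obtain C where C: "\<And>u. u \<in> V \<Longrightarrow> Re u \<ge> 0 \<Longrightarrow> cos (Im u) \<ge> 1/2 \<Longrightarrow>
        norm (\<zeta> (\<i> * of_real (Im u))) \<ge> C \<Longrightarrow> norm (f (\<zeta> u)) \<ge> exp (3/8 * exp (Re u))"
      by blast
    \<comment> \<open>The ray in the \<open>w\<close>-plane, parametrised by \<open>t = r\<^sup>n\<close>, and its image \<open>U\<close> in the \<open>u\<close>-plane.\<close>
    define w where "w t = of_real t * exp (\<i> * of_real (real n * \<theta>))" for t
    define U where "U t = w t + g (w t)" for t
    have w_Re: "Re (w t) = t * c0" and w_Im: "Im (w t) = t * s0" for t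
      by (simp_all add: w_def c0_def s0_def Re_exp Im_exp)
    have w_diff: "norm (w t - w t') = \<bar>t - t'\<bar>" for t t'
      by (simp add: w_def norm_mult flip: left_diff_distrib of_real_diff)
    have w_norm: "norm (w t) = \<bar>t\<bar>" for t using w_diff[of t 0] by (simp add: w_def)
    have dominates: "\<forall>\<^sub>F t in at_top. t * exp (exp (((1 - \<epsilon>) * c0) * t)) \<le> exp (3/8 * exp (((1 - \<epsilon>/4) * c0) * t - A))"
      using \<epsilon> c0 by (intro eventually_double_exp_dominates) auto
    then obtain T2 where T2: "\<And>t. t \<ge> T2 \<Longrightarrow>
        t * exp (exp (((1 - \<epsilon>) * c0) * t)) \<le> exp (3/8 * exp (((1 - \<epsilon>/4) * c0) * t - A))"
      by (auto simp: eventually_at_top_linorder)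
    \<comment> \<open>Beyond \<open>T\<close> the ray lies in \<open>V\<close> with \<open>Re u \<ge> 0\<close>, the double exponentials compare, and \<open>Im u\<close> is so large that \<open>\<bar>\<zeta> (i Im u)\<bar> \<ge> C\<close>.\<close>
    define T where "T = Max {1, 8 * (K + 5 * A + 1) / s0, 2 * A / c0, T2, 2 * (2 * A + 2 * \<bar>C\<bar> ^ n) / s0}"
    have T: "T \<ge> 1" "T \<ge> 8 * (K + 5 * A + 1) / s0" "T \<ge> 2 * A / c0" "T \<ge> T2"
       "T \<ge> 2 * (2 * A + 2 * \<bar>C\<bar> ^ n) / s0"
      unfolding T_def by (rule Max_ge; simp)+
    have scale: "b \<le> t * c" if "b / c \<le> T" "T \<le> t" "0 < c" for b c t
      using that order_trans[OF that(1,2)] by (simp add: pos_divide_le_eq)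
    have ts0: "t * s0 \<ge> 8 * (K + 5 * A + 1)" if "t \<ge> T" for t
      using scale[OF T(2) that s0(1)] .
    have w_K: "Im (w t) > K" if "t \<ge> T" for t
      using ts0[OF that] K A by (simp add: w_Im)
    have g_w: "norm (g (w t)) \<le> A + \<eta> * t" if "t \<ge> T" for t
      using gA[OF w_K[OF that]] that T(1) by (simp add: w_norm)
    have \<eta>_s0: "\<eta> * t \<le> s0 / 8 * t" and \<eta>_1: "\<eta> * t \<le> 1 * t" and \<eta>_c0: "\<eta> * t \<le> \<epsilon> * c0 / 4 * t" if "t \<ge> T" for t
      using that T(1) \<eta> by (auto intro!: mult_right_mono)
    have U_Im: "Im (U t) \<ge> t * s0 - (A + \<eta> * t)" if "t \<ge> T" for t
      using g_w[OF that] abs_Im_le_cmod[of "g (w t)"] by (simp add: U_def w_Im)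
    have U_V: "U t \<in> V" if t: "t \<ge> T" for t
    proof -
      have "norm (U t) \<le> norm (w t) + norm (g (w t))" unfolding U_def by (rule norm_triangle_ineq)
      also have "\<dots> \<le> t + (A + 1 * t)" using g_w[OF t] \<eta>_1[OF t] T(1) t unfolding w_norm by linarith
      finally have "\<eta> * norm (U t) \<le> \<eta> * (2 * t + A)" using \<eta> by (intro mult_left_mono) auto
      also have "\<dots> \<le> 2 * (\<eta> * t) + 1 * A" using \<eta>(2) A mult_right_mono[of \<eta> 1 A] by (simp add: distrib_left)
      finally have "K + 2 * A + 2 * \<eta> * norm (U t) \<le> K + 4 * A + 4 * (\<eta> * t)" by simp
      also have "\<dots> < t * s0 - (A + \<eta> * t)"
        using \<eta>_s0[OF t] ts0[OF t] A K by (simp add: mult.commute)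
      also have "\<dots> \<le> Im (U t)" by (rule U_Im[OF t])
      finally show ?thesis by (simp add: V_def tilted_half_plane_def)
    qed
    have U_Re: "Re (U t) \<ge> ((1 - \<epsilon>/4) * c0) * t - A" if t: "t \<ge> T" for t
      using g_w[OF t] abs_Re_le_cmod[of "g (w t)"] \<eta>_c0[OF t] by (simp add: U_def w_Re algebra_simps)
    have U_Re0: "Re (U t) \<ge> 0" if t: "t \<ge> T" for t
    proof -
      have "2 * A \<le> c0 * t" using scale[OF T(3) t c0] by (simp add: mult.commute)
      moreover have "1/2 * (c0 * t) \<le> (1 - \<epsilon>/4) * (c0 * t)"
        using \<epsilon> c0 t T(1) by (intro mult_right_mono) auto
      ultimately show ?thesis using U_Re[OF t] unfolding mult.assoc by linarith
    qed
    have \<zeta>_U: "\<zeta> (U (x ^ n)) = of_real x * exp (\<i> * of_real \<theta>)" if x: "x > 0" "x ^ n \<ge> T" for x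
    proof -
      have "w (x ^ n) = exp (of_real (real n * ln x)) * exp (\<i> * of_real (real n * \<theta>))"
        unfolding w_def exp_of_real using x by (simp add: exp_of_nat_mult)
      then have "w (x ^ n) = exp (of_real (real n * ln x) + \<i> * of_real (real n * \<theta>))"
        by (simp add: exp_add)
      then have "Ln (w (x ^ n)) = of_real (real n * ln x) + \<i> * of_real (real n * \<theta>)"
        using ang by (simp add: Ln_exp)
      then have "Ln (w (x ^ n)) / of_nat n = of_real (ln x) + \<i> * of_real \<theta>"
        using n by (simp add: field_simps)
      then have "\<zeta> (U (x ^ n)) = exp (of_real (ln x)) * exp (\<i> * of_real \<theta>)"
        using \<zeta>_inv[OF w_K[OF x(2)]] by (simp add: U_def exp_add)
      then show ?thesis unfolding exp_of_real using x by simp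
    qed
    have growth: "norm (f (\<zeta> (U t))) \<ge> t * exp (exp ((1 - \<epsilon>) * t * c0))"
      if t: "t \<ge> T" and cos: "cos (Im (U t)) \<ge> 1/2" for t
    proof -
      have "\<i> * of_real (Im (U t)) \<in> V"
        using tilted_half_plane_toward_axis[of "U t" _ _ 0] U_V[OF t] U_Re0[OF t] \<eta> by (simp add: V_def)
      then have *: "\<bar>Im (U t)\<bar> \<le> A + 2 * norm (\<zeta> (\<i> * of_real (Im (U t)))) ^ n"
        using \<zeta>_big by (fastforce simp: V_def norm_mult)
      have "norm (\<zeta> (\<i> * of_real (Im (U t)))) \<ge> C"
      proof (rule ccontr)
        assume "\<not> ?thesis"
        then have "norm (\<zeta> (\<i> * of_real (Im (U t)))) ^ n \<le> \<bar>C\<bar> ^ n" by (intro power_mono) auto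
        moreover have "t * s0 \<ge> 2 * (2 * A + 2 * \<bar>C\<bar> ^ n)"
          using scale[OF T(5) t s0(1)] .
        ultimately show False
          using * U_Im[OF t] \<eta>_s0[OF t] ts0[OF t] A K by (simp add: mult.commute)
      qed
      then have "exp (3/8 * exp (Re (U t))) \<le> norm (f (\<zeta> (U t)))"
        using C U_V[OF t] U_Re0[OF t] cos by blast
      moreover have "exp (3/8 * exp (((1 - \<epsilon>/4) * c0) * t - A)) \<le> exp (3/8 * exp (Re (U t)))"
        using U_Re[OF t] by simp
      moreover have "t * exp (exp (((1 - \<epsilon>) * c0) * t)) \<le> exp (3/8 * exp (((1 - \<epsilon>/4) * c0) * t - A))"
        using T2 T(4) t by auto
      moreover have "(1 - \<epsilon>) * t * c0 = ((1 - \<epsilon>) * c0) * t" by simp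
      ultimately show ?thesis by (metis order_trans)
    qed
    have Im_U_diff: "\<bar>(Im (U t') - Im (U t)) - s0 * (t' - t)\<bar> \<le> \<eta> * (t' - t)" if t: "T \<le> t" "t \<le> t'" for t t'
    proof -
      have "(Im (U t') - Im (U t)) - s0 * (t' - t) = Im (g (w t') - g (w t))"
        by (simp add: U_def w_Im algebra_simps)
      also have "\<bar>\<dots>\<bar> \<le> norm (g (w t') - g (w t))" by (rule abs_Im_le_cmod)
      also have "\<dots> \<le> \<eta> * norm (w t' - w t)" using t by (intro lip w_K) auto
      finally show ?thesis using t by (simp add: w_diff)
    qed
    obtain r :: "nat \<Rightarrow> real" where r: "\<And>k. r k > 0" "\<And>k. r k ^ n \<ge> T"
      and r_cos: "\<And>l x. x \<in> {r (2 * l)..r (2 * l + 1)} \<Longrightarrow> cos (Im (U (x ^ n))) \<ge> 1/2"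
      and r_log: "log_measure (\<Union>l. {r (2 * l)..r (2 * l + 1)}) = \<infinity>"
    proof (rule intervals_of_large_cosine[of n T "s0 / 2" "\<lambda>t. Im (U t)"])
      show "s0 / 2 * (t' - t) \<le> Im (U t') - Im (U t)" "Im (U t') - Im (U t) \<le> 2 * (t' - t)"
        if t: "T \<le> t" "t \<le> t'" for t t'
      proof -
        have "\<eta> * (t' - t) \<le> s0 / 2 * (t' - t)" "\<eta> * (t' - t) \<le> 1 * (t' - t)" "s0 * (t' - t) \<le> 1 * (t' - t)"
          using t \<eta> s0 by (intro mult_right_mono; linarith)+
        then show "s0 / 2 * (t' - t) \<le> Im (U t') - Im (U t)" "Im (U t') - Im (U t) \<le> 2 * (t' - t)"
          using Im_U_diff[OF t] by linarith+
      qed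
    qed (use n T(1) s0 in auto)
    show ?thesis
    proof (intro exI[of _ r] conjI allI, goal_cases)
      case (1 k)
      have "norm (\<zeta> (U (r k ^ n))) = r k" using \<zeta>_U[OF r] r(1)[of k] by (simp add: norm_mult)
      then show ?case using \<zeta>_R[of "U (r k ^ n)"] U_V[OF r(2)] by (simp add: V_def)
    next
      case 2
      show ?case unfolding Let_def
      proof (intro conjI ballI r_log)
        fix x assume "x \<in> (\<Union>l. {r (2 * l)..r (2 * l + 1)})"
        then obtain l where l: "x \<in> {r (2 * l)..r (2 * l + 1)}" by blast
        have x: "x > 0" using l r(1)[of "2 * l"] by simp
        have xT: "x ^ n \<ge> T" using r(2)[of "2 * l"] power_mono[of "r (2 * l)" x n] l r(1)[of "2 * l"] by simp
        have x1: "x \<ge> 1" using xT T(1) x n power_mono_iff[of 1 x n] by simp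
        have root: "root n s0 \<le> 1" "0 \<le> root n s0" using s0 n by auto
        \<comment> \<open>The factors \<open>1 - \<epsilon>\<close>, the root divided by \<open>n\<close>, and \<open>sin \<epsilon>\<close> are at most \<open>1\<close>.\<close>
        have "(1 - \<epsilon>) * (root n s0 / real n) * x * exp (exp ((1 - \<epsilon>) * x ^ n * c0) * sin \<epsilon>)
            \<le> 1 * (1 / 1) * x ^ n * exp (exp ((1 - \<epsilon>) * x ^ n * c0) * 1)"
        proof (intro mult_mono frac_le)
          show "x \<le> x ^ n" using x1 n by (simp add: self_le_power)
        qed (use \<epsilon> root n x x1 in \<open>auto intro!: mult_nonneg_nonneg\<close>)
        also have "\<dots> \<le> norm (f (\<zeta> (U (x ^ n))))" using growth[OF xT r_cos[OF l]] by simp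
        finally show "(1 - \<epsilon>) * (root n s0 / real n) * x * exp (exp ((1 - \<epsilon>) * x ^ n * c0) * sin \<epsilon>)
            \<le> norm (f (of_real x * exp (\<i> * of_real \<theta>)))"
          unfolding \<zeta>_U[OF x xT] .
      qed
    qed
  qed
  have "\<forall>\<^sub>F \<epsilon> :: real in at_right 0. 0 < \<epsilon> \<and> \<epsilon> < 1"
    by (auto simp: eventually_at_right_field intro: exI[of _ 1])
  then show ?thesis
    by eventually_elim (use main in \<open>auto simp: s0_def c0_def\<close>)
qed

end
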